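(* Let $n\ge1$. For $T\in L_n$, $$T\in\mathcal M_n\quad\Longleftrightarrow\quad T=\{b,\gamma(b),\gamma^2(b)\}\ \text{ for some } b\in\Delta_n,\ b\ne e_n .$$ Hence $$|\mathcal M_n\cap L_n|=\frac{4^n-1}{3}.$$
   Context: $\Delta_n=\{i,j,k,e\}^n$ is the set of words $b=b_1b_2\cdots b_n$ of length $n$ in the four symbols $i,j,k,e$; $e_n=ee\cdots e$. Put $v(i)=(\cos 210^\circ,\sin 210^\circ)$, $v(j)=(\cos 90^\circ,\sin 90^\circ)$, $v(k)=(\cos 330^\circ,\sin 330^\circ)$, $v(e)=(0,0)$ in $\mathbb R^2$. Fix a real $d_1>0$ and put $d_r=d_1/2^{r-1}$. The centroid map $P:\Delta_n\to\mathbb R^2$ is $$P(b)=\sum_{r=1}^n \sigma_r(b)\,d_r\,v(b_r),\qquad \sigma_r(b)=(-1)^{\#\{s<r:\ b_s=e\}}.$$ $E_n$ is the set of unordered triples $\{b_1,b_2,b_3\}$ of distinct words in $\Delta_n$ such that $P(b_1),P(b_2),P(b_3)$ are the vertices of a nondegenerate equilateral triangle. For $b\in\Delta_n$ put $\mathrm{supp}(b)=\{r: b_r\ne e\}$. Let $\gamma$ be the permutation $i\mapsto j\mapsto k\mapsto i$, $e\mapsto e$; $\gamma(b)$ is obtained by applying $\gamma$ to every coordinate of $b$. For nonempty $S\subseteq\mathrm{supp}(b)$, $\gamma_S(b)$ is obtained by applying $\gamma$ in the coordinates of $S$ and fixing the others, and $T(b,S)=\{b,\gamma_S(b),\gamma_S^2(b)\}$,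 which is always an element of $E_n$. The local class is $L_n=\{T(b,S): b\in\Delta_n,\ \varnothing\ne S\subseteq\mathrm{supp}(b)\}\subseteq E_n$. Words are multiplied coordinatewise as quaternions ($e$ the identity, $i^2=j^2=k^2=-e$, $ij=k$, $jk=i$, $ki=j$, distinct elements of $\{i,j,k\}$ anticommute), with local signs collected into one global sign, giving an element of $\{\pm b:b\in\Delta_n\}$; let $u(\pm b)=b$ for $b\in\Delta_n$. $T\in E_n$ is multiplication-generated if its vertices can be written $T=\{b,c,u(bc)\}$ with $b,c\in\Delta_n$; $\mathcal M_n$ is the set of multiplication-generated $T\in E_n$. *)

theory Defs
  imports "HOL-Analysis.Analysis"
begin

datatype qsym = Qi | Qj | Qk | Qe

type_synonym word = "qsym list"

text \<open>Positions in a word are counted from 0, as for lists: the paper's coordinate $b_r$ with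
  $1 \le r \le n$ is \<open>b ! (r - 1)\<close>, and the paper's $d_r = d_1 / 2^{r-1}$ is
  \<open>d / 2 ^ (r - 1)\<close>, where \<open>d\<close> stands for $d_1$.\<close>

definition words :: "nat \<Rightarrow> word set" where
  "words n = {b. length b = n}"

definition e_word :: "nat \<Rightarrow> word" where
  "e_word n = replicate n Qe"

fun dir :: "qsym \<Rightarrow> real ^ 2" where
  "dir Qi = vector [cos (210 * pi / 180), sin (210 * pi / 180)]"
| "dir Qj = vector [cos (90 * pi / 180), sin (90 * pi / 180)]"
| "dir Qk = vector [cos (330 * pi / 180), sin (330 * pi / 180)]"
| "dir Qe = 0"

definition sgn_at :: "word \<Rightarrow> nat \<Rightarrow> real" where
  "sgn_at b r = (- 1) ^ card {s. s < r \<and> b ! s = Qe}"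

definition centroid :: "real \<Rightarrow> word \<Rightarrow> real ^ 2" where
  "centroid d b = (\<Sum>r<length b. (sgn_at b r * (d / 2 ^ r)) *\<^sub>R dir (b ! r))"

definition equilateral :: "'a::metric_space \<Rightarrow> 'a \<Rightarrow> 'a \<Rightarrow> bool" where
  "equilateral x y z \<longleftrightarrow> dist x y = dist y z \<and> dist y z = dist z x \<and> dist x y > 0"

definition equilateral_triples :: "real \<Rightarrow> nat \<Rightarrow> word set set" where
  "equilateral_triples d n =
     {{b1, b2, b3} | b1 b2 b3.
        b1 \<in> words n \<and> b2 \<in> words n \<and> b3 \<in> words n \<and> distinct [b1, b2, b3] \<and>
        equilateral (centroid d b1) (centroid d b2) (centroid d b3)}"

definition supp :: "word \<Rightarrow> nat set" where
  "supp b = {r. r < length b \<and> b ! r \<noteq> Qe}"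

fun rot :: "qsym \<Rightarrow> qsym" where
  "rot Qi = Qj"
| "rot Qj = Qk"
| "rot Qk = Qi"
| "rot Qe = Qe"

definition rot_word :: "word \<Rightarrow> word" where
  "rot_word b = map rot b"

definition rot_on :: "nat set \<Rightarrow> word \<Rightarrow> word" where
  "rot_on S b = map (\<lambda>r. if r \<in> S then rot (b ! r) else b ! r) [0..<length b]"

definition local_triple :: "word \<Rightarrow> nat set \<Rightarrow> word set" where
  "local_triple b S = {b, rot_on S b, rot_on S (rot_on S b)}"

definition local_class :: "nat \<Rightarrow> word set set" where
  "local_class n = {local_triple b S | b S. b \<in> words n \<and> S \<noteq> {} \<and> S \<subseteq> supp b}"

text \<open>A pair \<open>(\<epsilon>, x)\<close> with \<open>\<epsilon> = 1\<close> or \<open>\<epsilon> = -1\<close> encodes the signed symbol or signed word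
  \<open>\<epsilon> x\<close>.\<close>

fun qmul :: "qsym \<Rightarrow> qsym \<Rightarrow> int \<times> qsym" where
  "qmul Qe y = (1, y)"
| "qmul x Qe = (1, x)"
| "qmul Qi Qi = (- 1, Qe)"
| "qmul Qj Qj = (- 1, Qe)"
| "qmul Qk Qk = (- 1, Qe)"
| "qmul Qi Qj = (1, Qk)"
| "qmul Qj Qk = (1, Qi)"
| "qmul Qk Qi = (1, Qj)"
| "qmul Qj Qi = (- 1, Qk)"
| "qmul Qk Qj = (- 1, Qi)"
| "qmul Qi Qk = (- 1, Qj)"

definition word_mul :: "word \<Rightarrow> word \<Rightarrow> int \<times> word" where
  "word_mul b c =
     (\<Prod>r<length b. fst (qmul (b ! r) (c ! r)), map2 (\<lambda>x y. snd (qmul x y)) b c)"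

definition unsigned_word :: "int \<times> word \<Rightarrow> word" where
  "unsigned_word w = snd w"

definition mult_generated :: "real \<Rightarrow> nat \<Rightarrow> word set set" where
  "mult_generated d n =
     {T \<in> equilateral_triples d n.
        \<exists>b\<in>words n. \<exists>c\<in>words n. T = {b, c, unsigned_word (word_mul b c)}}"

end

theory Submission
  imports Defs
begin

text \<open>
  Look at the three vertices of a local triple \<open>local_triple b S\<close> in a single coordinate. In a
  coordinate of \<open>S\<close> they show the three symbols \<open>Qi\<close>, \<open>Qj\<close>, \<open>Qk\<close>, and up to sign the product of any
  two of these is the third. In a coordinate outside \<open>S\<close> all three vertices show one symbol \<open>x\<close>; if one
  vertex is the product of the other two, then \<open>x = \<plusminus> x x\<close>, which forces \<open>x = Qe\<close>. So being
  multiplication-generated means that \<open>S\<close> is the whole support, and then the triple is the orbit of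
  \<open>b\<close> under the cyclic rotation of symbols.

  That these orbits are equilateral is seen in the plane: rotating symbols turns the centroid through
  a third of a full turn about the origin (\<open>centroid_rot_word\<close>), so an orbit is equilateral
  as soon as its centroid is not the origin. This is the case for every word other than the identity
  (\<open>centroid_nonzero\<close>), because the first nonzero term of the centroid sum is longer than all later
  terms together.

  For the count, the orbits of the nonidentity words partition these \<open>4 ^ n - 1\<close> words
  into blocks of size 3.
\<close>

section \<open>Orbits of words under rotation of symbols\<close>

abbreviation orbit :: "word \<Rightarrow> word set" where
  "orbit b \<equiv> {b, rot_word b, rot_word (rot_word b)}"

lemma rot_rot_rot [simp]: "rot (rot (rot x)) = x"
  by (cases x) auto

lemma rot_eq_Qe_iff [simp]: "rot x = Qe \<longleftrightarrow> x = Qe"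
  by (cases x) auto

lemma rot_fixed_iff: "rot x = x \<longleftrightarrow> x = Qe"
  by (cases x) auto

lemma length_rot_word [simp]: "length (rot_word b) = length b"
  by (simp add: rot_word_def)

lemma length_rot_on [simp]: "length (rot_on S b) = length b"
  by (simp add: rot_on_def)

lemma nth_rot_on:
  "r < length b \<Longrightarrow> rot_on S b ! r = (if r \<in> S then rot (b ! r) else b ! r)"
  by (simp add: rot_on_def)

lemma rot_word_cube [simp]: "rot_word (rot_word (rot_word b)) = b"
  by (simp add: rot_word_def o_def)

lemma rot_word_in_words [simp]: "rot_word b \<in> words n \<longleftrightarrow> b \<in> words n"
  by (simp add: words_def)

lemma eq_e_word_iff: "b \<in> words n \<Longrightarrow> b = e_word n \<longleftrightarrow> set b \<subseteq> {Qe}"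
proof
  show "b = e_word n \<Longrightarrow> set b \<subseteq> {Qe}" by (simp add: e_word_def set_replicate_conv_if)
  show "b \<in> words n \<Longrightarrow> set b \<subseteq> {Qe} \<Longrightarrow> b = e_word n"
    unfolding e_word_def by (rule replicate_eqI) (auto simp: words_def)
qed

lemma rot_word_eq_e_word_iff:
  assumes "b \<in> words n"
  shows "rot_word b = e_word n \<longleftrightarrow> b = e_word n"
proof -
  have "rot_word b = e_word n \<longleftrightarrow> set (rot_word b) \<subseteq> {Qe}"
    using assms by (simp add: eq_e_word_iff)
  also have "\<dots> \<longleftrightarrow> set b \<subseteq> {Qe}" by (auto simp: rot_word_def)
  finally show ?thesis using assms by (simp add: eq_e_word_iff)
qed

lemma rot_word_fixed:
  assumes "rot_word b = b"
  shows "set b \<subseteq> {Qe}"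
proof -
  have "\<forall>x\<in>set b. rot x = x"
    using assms map_eq_conv[of rot b id] by (simp add: rot_word_def)
  then show ?thesis by (auto simp: rot_fixed_iff)
qed

lemma rot_word_neq:
  assumes "b \<in> words n" "b \<noteq> e_word n"
  shows "rot_word b \<noteq> b"
  using assms rot_word_fixed[of b] by (auto simp: eq_e_word_iff)

lemma distinct_orbit:
  assumes "b \<in> words n" "b \<noteq> e_word n"
  shows "distinct [b, rot_word b, rot_word (rot_word b)]"
proof -
  have "rot_word (rot_word b) \<noteq> b"
  proof
    assume "rot_word (rot_word b) = b"
    then have "rot_word b = b" using rot_word_cube[of b] by simp
    then show False using rot_word_neq[OF assms] by simp
  qed
  moreover have "rot_word (rot_word b) \<noteq> rot_word b"
    using assms rot_word_eq_e_word_iff[OF assms(1)] by (intro rot_word_neq) simp_all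
  ultimately show ?thesis using rot_word_neq[OF assms] by auto
qed

lemma rot_on_supp: "supp b \<subseteq> S \<Longrightarrow> rot_on S b = rot_word b"
  by (rule nth_equalityI) (auto simp: rot_on_def rot_word_def supp_def)

lemma supp_rot_word [simp]: "supp (rot_word b) = supp b"
  by (auto simp: supp_def rot_word_def)

lemma local_triple_supp: "local_triple b (supp b) = orbit b"
  by (simp add: local_triple_def rot_on_supp)

lemma supp_nonempty:
  assumes "b \<in> words n" "b \<noteq> e_word n"
  shows "supp b \<noteq> {}"
  using assms by (auto simp: eq_e_word_iff supp_def in_set_conv_nth)

lemma orbit_in_local_class:
  assumes "b \<in> words n" "b \<noteq> e_word n"
  shows "orbit b \<in> local_class n"
  unfolding local_class_def local_triple_supp[symmetric]
  using assms supp_nonempty[OF assms] by blast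

section \<open>Centroids\<close>

lemma centroid_Nil: "centroid d [] = 0"
  by (simp add: centroid_def)

lemma sgn_at_Cons_Suc:
  "sgn_at (x # b) (Suc r) = (if x = Qe then - 1 else 1) * sgn_at b r"
proof -
  have "{s. s < Suc r \<and> (x # b) ! s = Qe} =
        (if x = Qe then {0} else {}) \<union> Suc ` {s. s < r \<and> b ! s = Qe}"
    (is "?A = ?B")
  proof (rule set_eqI)
    show "s \<in> ?A \<longleftrightarrow> s \<in> ?B" for s by (cases s) auto
  qed
  moreover have "card \<dots> = (if x = Qe then 1 else 0) + card {s. s < r \<and> b ! s = Qe}"
    by (subst card_Un_disjoint) (auto simp: card_image)
  ultimately show ?thesis by (simp add: sgn_at_def)
qed

text \<open>The signs and the weights halving at each step are both carried by the recursion: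
  a leading \<open>Qe\<close> flips every later sign, and dropping a letter halves the scale.\<close>

lemma centroid_Cons:
  "centroid d (x # b) =
     d *\<^sub>R dir x + (if x = Qe then - 1 else 1) *\<^sub>R centroid (d / 2) b"
proof -
  have "sgn_at (x # b) 0 = 1" by (simp add: sgn_at_def)
  then show ?thesis
    by (simp add: centroid_def sum.lessThan_Suc_shift sgn_at_Cons_Suc sum_negf
        del: sum.lessThan_Suc)
qed

lemma dir_values:
  "dir Qi = vector [- sqrt 3 / 2, - 1 / 2]"
  "dir Qj = vector [0, 1]"
  "dir Qk = vector [sqrt 3 / 2, - 1 / 2]"
proof -
  have i: "210 * pi / 180 = pi / 6 + pi" and j: "90 * pi / 180 = pi / 2"
    and k: "330 * pi / 180 = 2 * pi - pi / 6"
    by simp_all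
  show "dir Qi = vector [- sqrt 3 / 2, - 1 / 2]"
    unfolding dir.simps i cos_periodic_pi sin_periodic_pi by (simp add: cos_30 sin_30)
  show "dir Qj = vector [0, 1]"
    unfolding dir.simps j by simp
  show "dir Qk = vector [sqrt 3 / 2, - 1 / 2]"
    unfolding dir.simps k cos_diff sin_diff by (simp add: cos_30 sin_30)
qed

lemma norm_dir: "x \<noteq> Qe \<Longrightarrow> norm (dir x) = 1"
  by (cases x) (simp_all add: dir_values norm_eq_sqrt_inner inner_vec_def sum_2 del: dir.simps)

text \<open>The terms have lengths at most \<open>d\<close>, \<open>d / 2\<close>, \<open>d / 4\<close> and so on, and only finitely many of
  them occur, so the geometric bound is strict.\<close>

lemma norm_centroid_less:
  assumes "d > 0"
  shows "norm (centroid d b) < 2 * d"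
  using assms
proof (induction b arbitrary: d)
  case Nil
  then show ?case by (simp add: centroid_Nil)
next
  case (Cons x b)
  have "norm (dir x) \<le> 1" by (cases "x = Qe") (simp_all add: norm_dir)
  then have "norm (d *\<^sub>R dir x) \<le> d" using Cons.prems by simp
  moreover have "norm (centroid (d / 2) b) < d" using Cons.IH[of "d / 2"] Cons.prems by simp
  ultimately show ?case
    unfolding centroid_Cons
    by (intro le_less_trans[OF norm_triangle_ineq]) auto
qed

text \<open>The first letter other than \<open>Qe\<close> contributes a vector that, by the strict bound,
  the remaining letters cannot cancel.\<close>

lemma centroid_nonzero:
  assumes "d > 0" "\<not> set b \<subseteq> {Qe}"
  shows "centroid d b \<noteq> 0"
  using assms
proof (induction b arbitrary: d)
  case (Cons x b)
  show ?case
  proof (cases "x = Qe")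
    case True
    then show ?thesis using Cons by (simp add: centroid_Cons)
  next
    case False
    have "norm (centroid (d / 2) b) < norm (d *\<^sub>R dir x)"
      using norm_centroid_less[of "d / 2" b] norm_dir[OF False] Cons.prems(1) by simp
    then show ?thesis
      using False by (auto simp: centroid_Cons add_eq_0_iff)
  qed
qed simp

text \<open>Rotation of the plane through \<open>- 120\<close> degrees: the directions of \<open>Qi\<close>, \<open>Qj\<close>, \<open>Qk\<close> follow each
  other clockwise.\<close>

definition turn :: "real ^ 2 \<Rightarrow> real ^ 2" where
  "turn v = vector [- v $ 1 / 2 + sqrt 3 / 2 * v $ 2, - sqrt 3 / 2 * v $ 1 - v $ 2 / 2]"

lemma turn_add: "turn (v + w) = turn v + turn w"
  by (simp add: turn_def vec_eq_iff forall_2 algebra_simps add_divide_distrib diff_divide_distrib)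

lemma turn_scaleR: "turn (c *\<^sub>R v) = c *\<^sub>R turn v"
  by (simp add: turn_def vec_eq_iff forall_2 algebra_simps)

text \<open>The minimal polynomial of a rotation by a third of a turn. It gives both
  \<open>turn\<^sup>3 = 1\<close> and the absence of nonzero fixed vectors.\<close>

lemma turn_orbit_sum: "v + turn v + turn (turn v) = 0"
  by (simp add: turn_def vec_eq_iff forall_2 field_simps)

lemma turn_cube: "turn (turn (turn v)) = v"
proof -
  have "v + (turn v + turn (turn v)) = turn (turn (turn v)) + (turn v + turn (turn v))"
    using turn_orbit_sum[of v] turn_orbit_sum[of "turn v"] by (simp add: algebra_simps)
  then show ?thesis by simp
qed

lemma dist_turn: "dist (turn v) (turn w) = dist v w"
proof -
  have "turn v - turn w = turn (v - w)"
    using turn_add[of "v - w" w] by simp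
  moreover have "norm (turn u) = norm u" for u
    by (simp add: turn_def norm_eq_sqrt_inner inner_vec_def sum_2 field_simps)
  ultimately show ?thesis by (simp add: dist_norm)
qed

lemma turn_fixed:
  assumes "turn v = v"
  shows "v = 0"
proof -
  have "3 *\<^sub>R v = 0" using turn_orbit_sum[of v] assms by (simp add: vec_eq_iff)
  then show ?thesis by simp
qed

lemma equilateral_turn:
  assumes "v \<noteq> 0"
  shows "equilateral v (turn v) (turn (turn v))"
proof -
  have "dist (turn (turn v)) v = dist (turn (turn v)) (turn (turn (turn v)))"
    by (simp add: turn_cube)
  then show ?thesis
    using assms turn_fixed[of v] by (auto simp: equilateral_def dist_turn)
qed

lemma dir_rot: "dir (rot x) = turn (dir x)"
  by (cases x)
    (simp_all add: dir_values turn_def vec_eq_iff forall_2 del: dir.simps(1-3))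

lemma centroid_rot_word: "centroid d (rot_word b) = turn (centroid d b)"
proof (induction b arbitrary: d)
  case Nil
  then show ?case
    using turn_scaleR[of 0 0] by (simp add: rot_word_def centroid_Nil)
next
  case (Cons x b)
  have "centroid d (rot_word (x # b)) =
      d *\<^sub>R dir (rot x) + (if x = Qe then - 1 else 1) *\<^sub>R centroid (d / 2) (rot_word b)"
    by (simp add: rot_word_def centroid_Cons)
  then show ?case
    by (simp only: Cons.IH centroid_Cons dir_rot turn_add turn_scaleR)
qed

lemma orbit_equilateral:
  assumes "d > 0" "b \<in> words n" "b \<noteq> e_word n"
  shows "orbit b \<in> equilateral_triples d n"
proof -
  have "centroid d b \<noteq> 0"
    using assms by (simp add: centroid_nonzero eq_e_word_iff)
  then have "equilateral (centroid d b) (centroid d (rot_word b)) (centroid d (rot_word (rot_word b)))"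
    by (simp add: centroid_rot_word equilateral_turn)
  then show ?thesis
    unfolding equilateral_triples_def mem_Collect_eq
    using assms(2) distinct_orbit[OF assms(2,3)]
    by (intro exI[of _ b] exI[of _ "rot_word b"] exI[of _ "rot_word (rot_word b)"]) simp
qed

section \<open>Multiplication-generated local triples\<close>

lemma snd_qmul_rot: "snd (qmul x (rot x)) = rot (rot x)"
  by (cases x) auto

lemma snd_qmul_self: "snd (qmul x x) = Qe"
  by (cases x) auto

lemma nth_unsigned_word_mul:
  "r < length b \<Longrightarrow> r < length c \<Longrightarrow>
     unsigned_word (word_mul b c) ! r = snd (qmul (b ! r) (c ! r))"
  by (simp add: unsigned_word_def word_mul_def)

lemma unsigned_word_mul_rot:
  "unsigned_word (word_mul b (rot_word b)) = rot_word (rot_word b)"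
  by (rule nth_equalityI)
    (auto simp: unsigned_word_def word_mul_def rot_word_def snd_qmul_rot)

lemma orbit_mult_generated:
  assumes "d > 0" "b \<in> words n" "b \<noteq> e_word n"
  shows "orbit b \<in> mult_generated d n"
proof -
  have "\<exists>c\<in>words n. orbit b = {b, c, unsigned_word (word_mul b c)}"
    using assms(2) by (intro bexI[of _ "rot_word b"]) (simp_all add: unsigned_word_mul_rot)
  then show ?thesis
    unfolding mult_generated_def mem_Collect_eq
    using orbit_equilateral[OF assms] bexI[OF _ assms(2)] by (intro conjI)
qed

text \<open>In a coordinate that \<open>S\<close> leaves alone, all three vertices carry the same symbol, and a symbol
  that agrees with its own square up to sign is \<open>Qe\<close>.\<close>

lemma product_triple_supp:
  assumes "length b1 = length b" "length c1 = length b"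
    and eq: "local_triple b S = {b1, c1, unsigned_word (word_mul b1 c1)}"
  shows "supp b \<subseteq> S"
proof (rule ccontr)
  assume "\<not> supp b \<subseteq> S"
  then obtain r where r: "r < length b" "b ! r \<noteq> Qe" "r \<notin> S"
    by (auto simp: supp_def)
  have same: "w ! r = b ! r" if "w \<in> local_triple b S" for w
    using that r by (auto simp: local_triple_def nth_rot_on)
  have "b1 ! r = b ! r" "c1 ! r = b ! r" "unsigned_word (word_mul b1 c1) ! r = b ! r"
    by (rule same, simp add: eq)+
  then have "b ! r = snd (qmul (b ! r) (b ! r))"
    using r assms(1,2) by (simp add: nth_unsigned_word_mul)
  then show False using r(2) by (simp add: snd_qmul_self)
qed

lemma mult_generated_local_iff:
  assumes "d > 0" "T \<in> local_class n"
  shows "T \<in> mult_generated d n \<longleftrightarrow> (\<exists>b\<in>words n. b \<noteq> e_word n \<and> T = orbit b)"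
proof
  assume "T \<in> mult_generated d n"
  then obtain b1 c1 where 1: "b1 \<in> words n" "c1 \<in> words n"
    "T = {b1, c1, unsigned_word (word_mul b1 c1)}"
    by (auto simp: mult_generated_def)
  obtain b S where 2: "b \<in> words n" "S \<noteq> {}" "S \<subseteq> supp b" "T = local_triple b S"
    using assms(2) by (auto simp: local_class_def)
  have "supp b \<subseteq> S"
    using 1 2 by (intro product_triple_supp[of b1 b c1]) (auto simp: words_def)
  then have "T = orbit b" using 2 local_triple_supp by auto
  moreover have "b \<noteq> e_word n" using 2 by (auto simp: supp_def e_word_def)
  ultimately show "\<exists>b\<in>words n. b \<noteq> e_word n \<and> T = orbit b" using 2(1) by blast
next
  assume "\<exists>b\<in>words n. b \<noteq> e_word n \<and> T = orbit b"
  then show "T \<in> mult_generated d n" using orbit_mult_generated[OF assms(1)] by blast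
qed

section \<open>Counting orbits\<close>

lemma UNIV_qsym: "(UNIV :: qsym set) = {Qi, Qj, Qk, Qe}"
  using qsym.exhaust by blast

lemma finite_words: "finite (words n)" and card_words: "card (words n) = 4 ^ n"
proof -
  have fin: "finite (UNIV :: qsym set)" and card: "card (UNIV :: qsym set) = 4"
    unfolding UNIV_qsym by simp_all
  show "finite (words n)"
    using finite_lists_length_eq[OF fin, of n] by (simp add: words_def)
  show "card (words n) = 4 ^ n"
    using card_lists_length_eq[OF fin, of n] card by (simp add: words_def)
qed

lemma orbits_disjoint:
  assumes "orbit b \<inter> orbit c \<noteq> {}"
  shows "orbit b = orbit c"
proof -
  have orbit_eq: "orbit w = orbit b" if "w \<in> orbit b" for w b :: word
    using that by auto
  show ?thesis using assms orbit_eq by blast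
qed

lemma card_orbits: "3 * card (orbit ` (words n - {e_word n})) = 4 ^ n - 1"
proof -
  let ?W = "words n - {e_word n}"
  have Un: "\<Union> (orbit ` ?W) = ?W"
    by (auto simp: rot_word_eq_e_word_iff)
  have "3 * card (orbit ` ?W) = card (\<Union> (orbit ` ?W))"
  proof (rule card_partition)
    show "finite (orbit ` ?W)" "finite (\<Union> (orbit ` ?W))"
      by (auto simp: finite_words)
    show "card T = 3" if "T \<in> orbit ` ?W" for T
    proof -
      obtain b where b: "b \<in> words n" "b \<noteq> e_word n" "T = orbit b" using \<open>T \<in> orbit ` ?W\<close> by blast
      then show ?thesis using distinct_card[OF distinct_orbit[OF b(1,2)]] by simp
    qed
    show "T \<inter> U = {}" if "T \<in> orbit ` ?W" "U \<in> orbit ` ?W" "T \<noteq> U" for T U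
      using that orbits_disjoint by (elim imageE) metis
  qed
  also have "\<dots> = 4 ^ n - 1"
  proof -
    have "e_word n \<in> words n" by (simp add: words_def e_word_def)
    then show ?thesis unfolding Un by (simp add: card_Diff_singleton card_words)
  qed
  finally show ?thesis .
qed

theorem corollary9p6:
  fixes n :: nat and d :: real
  assumes "n \<ge> 1" and "d > 0"
  shows "(\<forall>T\<in>local_class n.
            T \<in> mult_generated d n \<longleftrightarrow>
            (\<exists>b\<in>words n. b \<noteq> e_word n \<and> T = {b, rot_word b, rot_word (rot_word b)})) \<and>
         real (card (mult_generated d n \<inter> local_class n)) = (4 ^ n - 1) / 3"
proof
  show "\<forall>T\<in>local_class n. T \<in> mult_generated d n \<longleftrightarrow>
      (\<exists>b\<in>words n. b \<noteq> e_word n \<and> T = orbit b)"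
    using mult_generated_local_iff[OF assms(2)] by blast
  have "mult_generated d n \<inter> local_class n = orbit ` (words n - {e_word n})"
  proof (intro equalityI subsetI)
    fix T assume "T \<in> mult_generated d n \<inter> local_class n"
    then show "T \<in> orbit ` (words n - {e_word n})"
      using mult_generated_local_iff[OF assms(2), of T n] by blast
  next
    fix T assume "T \<in> orbit ` (words n - {e_word n})"
    then show "T \<in> mult_generated d n \<inter> local_class n"
      using orbit_mult_generated[OF assms(2)] orbit_in_local_class by blast
  qed
  then have "3 * card (mult_generated d n \<inter> local_class n) = 4 ^ n - 1"
    by (simp only: card_orbits)
  then have "real (3 * card (mult_generated d n \<inter> local_class n)) = 4 ^ n - 1"
    by (simp only: of_nat_diff one_le_power of_nat_power of_nat_numeral of_nat_1)
  then show "real (card (mult_generated d n \<inter> local_class n)) = (4 ^ n - 1) / 3"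
    by simp
qed

end
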